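(* Let $S$ be a set and assume that there exists a filtration $\mathbf{S}=(S_i)_{i\in\mathbb{N}_0}$ of $S$ such that each $S_i$ is finite. Let $\mathcal{N}(S)$ be the topology on $\mathrm{TO}(S)$ induced by the metric $d_{\mathbf{S}}$, that is, $\mathfrak{N}\in\mathcal{N}(S)$ if and only if $\mathfrak{N}$ is a union of finite intersections of sets of the form $\mathfrak{N}_r({\preceq})=\{{\preceq'}\in\mathrm{TO}(S)\mid d_{\mathbf{S}}({\preceq},{\preceq'})<2^{-r}\}$ with $r\in\mathbb{N}_0$ and ${\preceq}\in\mathrm{TO}(S)$. Then $\mathcal{N}(S)=\mathcal{U}(S)$; in particular the topology $\mathcal{N}(S)$ is independent of the choice of $\mathbf{S}$, and the topology $\mathcal{U}(S)$ is Hausdorff.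
   Context: For a set $S$, $\mathrm{TO}(S)$ is the set of all total orderings on $S$ (antisymmetric, transitive, total binary relations). $\mathcal{U}(S)$ is the topology on $\mathrm{TO}(S)$ having as subbasis the sets $\mathfrak{U}_{(a,b)}=\{{\preceq}\in\mathrm{TO}(S)\mid a\preceq b\}$, $(a,b)\in S\times S$. A filtration of $S$ is a family $\mathbf{S}=(S_i)_{i\in\mathbb{N}_0}$ of subsets of $S$ with $S_0=\emptyset$, $S_i\subseteq S_{i+1}$ for all $i$, and $S=\bigcup_{i\in\mathbb{N}_0}S_i$. The associated metric on $\mathrm{TO}(S)$ is $d_{\mathbf{S}}({\preceq'},{\preceq''})=2^{-r}$, where $r=\sup\{i\in\mathbb{N}_0\mid {\preceq'}\text{ and }{\preceq''}\text{ have the same restriction to }S_i\}$ (with $2^{-\infty}=0$). *)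

theory Defs
  imports "HOL-Analysis.Analysis" "HOL-Library.Extended_Nat"
begin

text \<open>
  \<^const>\<open>linear_order_on\<close> also asks that the relation be contained in \<open>S \<times> S\<close>, so distinct
  elements of \<open>total_orders S\<close> differ as relations on \<open>S\<close>.
  Its \<open>refl_on\<close> and \<open>total_on\<close> parts together say
  that any two (possibly equal) elements are comparable.
\<close>
definition total_orders :: "'a set \<Rightarrow> 'a rel set" where
  "total_orders S = {r. linear_order_on S r}"

text \<open>
  The topology on \<open>X\<close> with subbasis \<open>B\<close>: unions of finite intersections of members of \<open>B\<close>, where
  the empty intersection is \<open>X\<close>. This differs from
  \<^const>\<open>topology_generated_by\<close>, whose space is only \<open>\<Union>B\<close>: for \<open>S = {}\<close> the subbasis of
  \<open>order_topology_on\<close> below is empty, although \<open>total_orders {} = {{}}\<close>.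
\<close>
definition subbasis_topology :: "'b set \<Rightarrow> 'b set set \<Rightarrow> 'b topology" where
  "subbasis_topology X B =
     topology (arbitrary union_of (finite intersection_of (\<lambda>V. V \<in> B) relative_to X))"

definition order_topology_on :: "'a set \<Rightarrow> 'a rel topology" where
  "order_topology_on S = subbasis_topology (total_orders S)
     {{r \<in> total_orders S. (a, b) \<in> r} | a b. (a, b) \<in> S \<times> S}"

definition filtration :: "'a set \<Rightarrow> (nat \<Rightarrow> 'a set) \<Rightarrow> bool" where
  "filtration S F \<longleftrightarrow> F 0 = {} \<and> (\<forall>i. F i \<subseteq> F (Suc i)) \<and> S = (\<Union>i. F i)"

definition agreement_level :: "(nat \<Rightarrow> 'a set) \<Rightarrow> 'a rel \<Rightarrow> 'a rel \<Rightarrow> enat" where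
  "agreement_level F r r' = Sup {enat i | i. Restr r (F i) = Restr r' (F i)}"

definition filtration_dist :: "(nat \<Rightarrow> 'a set) \<Rightarrow> 'a rel \<Rightarrow> 'a rel \<Rightarrow> real" where
  "filtration_dist F r r' =
     (case agreement_level F r r' of enat n \<Rightarrow> 1 / 2 ^ n | \<infinity> \<Rightarrow> 0)"

definition filtration_nbhd :: "'a set \<Rightarrow> (nat \<Rightarrow> 'a set) \<Rightarrow> nat \<Rightarrow> 'a rel \<Rightarrow> 'a rel set" where
  "filtration_nbhd S F n r = {r' \<in> total_orders S. filtration_dist F r r' < 1 / 2 ^ n}"

definition filtration_topology :: "'a set \<Rightarrow> (nat \<Rightarrow> 'a set) \<Rightarrow> 'a rel topology" where
  "filtration_topology S F = subbasis_topology (total_orders S)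
     {filtration_nbhd S F n r | n r. r \<in> total_orders S}"

end

theory Submission
  imports Defs
begin

text \<open>
  Two orders are at distance less than \<open>2\<^sup>-\<^sup>n\<close> iff they agree on \<open>F (n + 1)\<close>, so metric balls are
  described by finitely many comparisons. Two total orders agree on a set as soon as one contains the
  restriction of the other, which turns a ball into a finite intersection of subbasic sets of
  the order topology. Conversely every pair \<open>(a, b)\<close> lies in some \<open>F (n + 1)\<close>, so a subbasic
  set contains the ball of radius \<open>2\<^sup>-\<^sup>n\<close> around each of its points.
\<close>

section \<open>Topologies given by a subbasis\<close>

lemma openin_subbasis_topology_subbasis:
  assumes "V \<in> B" "V \<subseteq> X"
  shows "openin (subbasis_topology X B) V"
proof -
  have "(finite intersection_of (\<lambda>V. V \<in> B) relative_to X) (X \<inter> V)"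
    using assms by (intro relative_to_inc finite_intersection_of_inc)
  moreover have "X \<inter> V = V" using assms by blast
  ultimately show ?thesis
    unfolding subbasis_topology_def openin_subbase
    by (simp add: arbitrary_union_of_inc)
qed

text \<open>Minimality among the topologies on \<open>X\<close> in which the members of
  \<open>B\<close> are open gives one inclusion; as openness is local, \<open>nbhd\<close> gives the
  other. Both identifications with the metric topology go through this criterion.\<close>

lemma subbasis_topology_eqI:
  assumes X: "topspace T = X"
    and B: "\<And>V. V \<in> B \<Longrightarrow> openin T V"
    and nbhd: "\<And>U x. openin T U \<Longrightarrow> x \<in> U
           \<Longrightarrow> \<exists>W. openin (subbasis_topology X B) W \<and> x \<in> W \<and> W \<subseteq> U"
  shows "subbasis_topology X B = T"
proof -
  \<comment> \<open>Minimality also requires \<open>X\<close> itself, the empty intersection, to be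
    open in \<open>T\<close>.\<close>
  have "openin T U" if "openin (subbasis_topology X B) U" for U
    using that B X unfolding subbasis_topology_def
    by (metis minimal_topology_subbase openin_topspace)
  moreover have "openin (subbasis_topology X B) U" if "openin T U" for U
    using nbhd[OF that] by (subst openin_subopen) blast
  ultimately show ?thesis
    unfolding topology_eq by blast
qed

lemma topspace_subbasis_topology [simp]: "topspace (subbasis_topology X B) = X"
  unfolding subbasis_topology_def by (rule topspace_subbase)

section \<open>Distance and restrictions\<close>

lemma filtration_mono: "filtration S F \<Longrightarrow> i \<le> j \<Longrightarrow> F i \<subseteq> F j"
  unfolding filtration_def by (rule lift_Suc_mono_le) auto

text \<open>As the sets \<open>F i\<close> are nested, the indices of agreement are closed
  downwards; they include 0 because \<open>F 0\<close> is empty. So a supremum of at least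
  \<open>i\<close> forces agreement on \<open>F i\<close> itself.\<close>

lemma enat_le_agreement_level_iff:
  assumes "filtration S F"
  shows "enat i \<le> agreement_level F r r' \<longleftrightarrow> Restr r (F i) = Restr r' (F i)"
proof
  assume "Restr r (F i) = Restr r' (F i)"
  then show "enat i \<le> agreement_level F r r'"
    unfolding agreement_level_def by (intro Sup_upper) blast
next
  assume le: "enat i \<le> agreement_level F r r'"
  show "Restr r (F i) = Restr r' (F i)"
  proof (cases i)
    case 0
    then show ?thesis using assms by (simp add: filtration_def)
  next
    case (Suc k)
    show ?thesis
    proof (rule ccontr)
      assume ne: "Restr r (F i) \<noteq> Restr r' (F i)"
      \<comment> \<open>Disagreement on \<open>F i\<close> persists on every larger set, so the
        supremum is at most \<open>k\<close>, the predecessor of \<open>i\<close>.\<close>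
      have "j \<le> k" if "Restr r (F j) = Restr r' (F j)" for j
      proof (rule ccontr)
        assume "\<not> j \<le> k"
        then have "F i \<subseteq> F j" using filtration_mono[OF assms, of i j] Suc by simp
        then show False using that ne by blast
      qed
      then have "agreement_level F r r' \<le> enat k"
        unfolding agreement_level_def by (intro Sup_least) auto
      from order_trans[OF le this] show False using Suc by simp
    qed
  qed
qed

text \<open>Nonzero distances are powers of 1/2, so the strict bound amounts to a level of at least
  \<open>n + 1\<close>; this is the source of the shift to \<open>Suc n\<close>.\<close>

lemma filtration_dist_less_iff:
  assumes "filtration S F"
  shows "filtration_dist F r r' < 1 / 2 ^ n
    \<longleftrightarrow> Restr r (F (Suc n)) = Restr r' (F (Suc n))"
proof -
  have "filtration_dist F r r' < 1 / 2 ^ n \<longleftrightarrow> enat (Suc n) \<le> agreement_level F r r'"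
    unfolding filtration_dist_def
    by (auto split: enat.split simp: field_simps)
  then show ?thesis
    using enat_le_agreement_level_iff[OF assms] by simp
qed

section \<open>The metric axioms\<close>

lemma filtration_dist_antimono:
  assumes "agreement_level F x y \<le> agreement_level F x' y'"
  shows "filtration_dist F x' y' \<le> filtration_dist F x y"
  using assms unfolding filtration_dist_def
  by (auto split: enat.split simp: field_simps)

lemma filtration_dist_nonneg: "0 \<le> filtration_dist F r r'"
  unfolding filtration_dist_def by (auto split: enat.split)

lemma filtration_dist_commute: "filtration_dist F r r' = filtration_dist F r' r"
proof -
  have "(Restr r (F i) = Restr r' (F i)) = (Restr r' (F i) = Restr r (F i))" for i
    by blast
  then show ?thesis
    unfolding filtration_dist_def agreement_level_def by simp
qed

text \<open>Agreement on a fixed \<open>F i\<close> is transitive, so the level of \<open>x\<close>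
  and \<open>z\<close> is at least the smaller of the other two levels.\<close>

lemma filtration_dist_ultrametric:
  assumes "filtration S F"
  shows "filtration_dist F x z \<le> max (filtration_dist F x y) (filtration_dist F y z)"
proof -
  have "enat i \<le> agreement_level F x z"
    if "enat i \<le> min (agreement_level F x y) (agreement_level F y z)" for i
    using that enat_le_agreement_level_iff[OF assms] by simp
  \<comment> \<open>An inequality in \<open>enat\<close> can be tested on the finite lower bounds of
    its left side: were the right side a smaller number \<open>m\<close>, then \<open>Suc m\<close>
    would be a counterexample.\<close>
  then have "min (agreement_level F x y) (agreement_level F y z) \<le> agreement_level F x z"
    by (metis Suc_n_not_le_n enat.exhaust enat_ord_code(3) enat_ord_simps(1) order_refl)
  then have "agreement_level F x y \<le> agreement_level F x z
      \<or> agreement_level F y z \<le> agreement_level F x z"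
    by (auto simp: min_def split: if_splits)
  then show ?thesis
    using filtration_dist_antimono by (metis le_max_iff_disj)
qed

text \<open>The index has the form \<open>Suc n\<close> to match the ball of radius
  \<open>1 / 2 ^ n\<close>.\<close>

lemma filtration_pair_eventually:
  assumes "filtration S F" "a \<in> S" "b \<in> S"
  obtains n where "a \<in> F (Suc n)" "b \<in> F (Suc n)"
proof -
  obtain i j where "a \<in> F i" "b \<in> F j"
    using assms unfolding filtration_def by blast
  moreover have "F i \<subseteq> F (Suc (max i j))" "F j \<subseteq> F (Suc (max i j))"
    using filtration_mono[OF assms(1)] by simp_all
  ultimately show thesis using that by blast
qed

lemma total_orders_subset: "r \<in> total_orders S \<Longrightarrow> r \<subseteq> S \<times> S"
  unfolding total_orders_def order_on_defs by auto

lemma filtration_dist_eq_0_iff: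
  assumes F: "filtration S F" and r: "r \<in> total_orders S" "r' \<in> total_orders S"
  shows "filtration_dist F r r' = 0 \<longleftrightarrow> r = r'"
proof
  assume "filtration_dist F r r' = 0"
  then have eq: "Restr r (F (Suc n)) = Restr r' (F (Suc n))" for n
    using filtration_dist_less_iff[OF F, of r r' n] by simp
  have "(a, b) \<in> r \<longleftrightarrow> (a, b) \<in> r'" if ab: "a \<in> S" "b \<in> S" for a b
    using filtration_pair_eventually[OF F ab] eq by blast
  then show "r = r'"
    using total_orders_subset[OF r(1)] total_orders_subset[OF r(2)] by auto
next
  assume "r = r'"
  \<comment> \<open>Equal orders agree on every \<open>F (Suc n)\<close>, so their distance lies
    below all powers of 1/2 and vanishes by the Archimedean property.\<close>
  then have "filtration_dist F r r' < (1 / 2) ^ n" for n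
    using filtration_dist_less_iff[OF F, of r r' n] by (simp add: power_one_over)
  then show "filtration_dist F r r' = 0"
    using filtration_dist_nonneg[of F r r'] real_arch_pow_inv[of "filtration_dist F r r'" "1 / 2"]
    by (fastforce dest: less_asym)
qed

lemma Metric_space_filtration_dist:
  assumes "filtration S F"
  shows "Metric_space (total_orders S) (filtration_dist F)"
proof
  fix x y z
  show "0 \<le> filtration_dist F x y" by (rule filtration_dist_nonneg)
  show "filtration_dist F x y = filtration_dist F y x" by (rule filtration_dist_commute)
  show "filtration_dist F x z \<le> filtration_dist F x y + filtration_dist F y z"
    using filtration_dist_ultrametric[OF assms, of x z y]
      filtration_dist_nonneg[of F x y] filtration_dist_nonneg[of F y z] by linarith
  show "filtration_dist F x y = 0 \<longleftrightarrow> x = y"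
    if "x \<in> total_orders S" "y \<in> total_orders S"
    using filtration_dist_eq_0_iff[OF assms that] .
qed

section \<open>Dyadic balls and the metric topology\<close>

lemma filtration_nbhd_eq_mball:
  assumes "filtration S F" "r \<in> total_orders S"
  shows "filtration_nbhd S F n r
    = Metric_space.mball (total_orders S) (filtration_dist F) r (1 / 2 ^ n)"
proof -
  interpret Metric_space "total_orders S" "filtration_dist F"
    using assms(1) by (rule Metric_space_filtration_dist)
  show ?thesis
    using assms(2) by (auto simp: filtration_nbhd_def)
qed

lemma self_in_filtration_nbhd:
  assumes "filtration S F" "r \<in> total_orders S"
  shows "r \<in> filtration_nbhd S F n r"
  using assms by (simp add: filtration_nbhd_def filtration_dist_less_iff)

lemma filtration_nbhd_basis:
  assumes "filtration S F"
    and "openin (Metric_space.mtopology (total_orders S) (filtration_dist F)) U" "r \<in> U"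
  obtains n where "filtration_nbhd S F n r \<subseteq> U"
proof -
  interpret Metric_space "total_orders S" "filtration_dist F"
    using assms(1) by (rule Metric_space_filtration_dist)
  from assms obtain e where e: "e > 0" "mball r e \<subseteq> U" and r: "r \<in> total_orders S"
    unfolding openin_mtopology by blast
  obtain n where "(1 / 2) ^ n < e"
    using real_arch_pow_inv[of e "1 / 2"] e by auto
  then have "mball r (1 / 2 ^ n) \<subseteq> mball r e"
    by (intro mball_subset_concentric) (simp add: power_one_over)
  then show thesis
    using that e filtration_nbhd_eq_mball[OF assms(1) r] by blast
qed

lemma filtration_topology_eq_mtopology:
  assumes "filtration S F"
  shows "filtration_topology S F
    = Metric_space.mtopology (total_orders S) (filtration_dist F)"
proof -
  interpret Metric_space "total_orders S" "filtration_dist F"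
    using assms by (rule Metric_space_filtration_dist)
  let ?B = "{filtration_nbhd S F n r | n r. r \<in> total_orders S}"
  show ?thesis
    unfolding filtration_topology_def
  proof (rule subbasis_topology_eqI)
    show "topspace mtopology = total_orders S" by simp
    show "openin mtopology V" if "V \<in> ?B" for V
      using that filtration_nbhd_eq_mball[OF assms] by auto
  next
    fix U r assume U: "openin mtopology U" "r \<in> U"
    then have r: "r \<in> total_orders S" using openin_subset by fastforce
    obtain n where n: "filtration_nbhd S F n r \<subseteq> U"
      using filtration_nbhd_basis[OF assms U] .
    have "openin (subbasis_topology (total_orders S) ?B) (filtration_nbhd S F n r)"
      using r by (intro openin_subbasis_topology_subbasis) (auto simp: filtration_nbhd_def)
    then show "\<exists>W. openin (subbasis_topology (total_orders S) ?B) W \<and> r \<in> W \<and> W \<subseteq> U"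
      using n self_in_filtration_nbhd[OF assms r] by blast
  qed
qed

section \<open>Comparison with the order topology\<close>

lemma total_orders_Restr_eq_iff:
  assumes "r \<in> total_orders S" "r' \<in> total_orders S" "A \<subseteq> S"
  shows "Restr r A = Restr r' A \<longleftrightarrow> Restr r A \<subseteq> r'"
proof
  assume sub: "Restr r A \<subseteq> r'"
  \<comment> \<open>If \<open>r\<close> lacked the pair, reflexivity and totality would put
    \<open>(b, a)\<close> into \<open>r\<close> with \<open>a \<noteq> b\<close>, hence into
    \<open>r'\<close>, against antisymmetry.\<close>
  have "(a, b) \<in> r" if ab: "(a, b) \<in> r'" "a \<in> A" "b \<in> A" for a b
  proof (rule ccontr)
    assume "(a, b) \<notin> r"
    moreover have "refl_on S r" "total_on S r"
      using assms(1) by (auto simp: total_orders_def order_on_defs)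
    moreover have "a \<in> S" "b \<in> S" using ab assms(3) by blast+
    ultimately have "a \<noteq> b \<and> (b, a) \<in> r"
      by (metis refl_onD total_on_def)
    then have "a \<noteq> b" "(b, a) \<in> r" by simp_all
    then have "(b, a) \<in> r'" using sub ab by blast
    moreover have "antisym r'"
      using assms(2) by (auto simp: total_orders_def order_on_defs)
    ultimately show False using ab(1) \<open>a \<noteq> b\<close> by (auto dest: antisymD)
  qed
  then show "Restr r A = Restr r' A" using sub by blast
qed blast

text \<open>Finiteness of the \<open>F i\<close> enters here: the ball is cut out by the finitely
  many pairs of \<open>r\<close> inside \<open>F (Suc n)\<close>.\<close>

lemma openin_order_topology_on_filtration_nbhd:
  assumes F: "filtration S F" and fin: "\<And>i. finite (F i)" and r: "r \<in> total_orders S"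
  shows "openin (order_topology_on S) (filtration_nbhd S F n r)"
proof -
  let ?A = "F (Suc n)"
  let ?f = "\<lambda>(a, b). {r' \<in> total_orders S. (a, b) \<in> r'}"
  have A: "?A \<subseteq> S" using F unfolding filtration_def by blast
  have "openin (order_topology_on S) (?f p)" if p: "p \<in> Restr r ?A" for p
    unfolding order_topology_on_def
    by (rule openin_subbasis_topology_subbasis) (use p A in auto)
  moreover have "finite (Restr r ?A)" using fin by blast
  \<comment> \<open>Intersecting with the whole space covers an empty \<open>F (Suc n)\<close>,
    where the bare intersection would be \<open>UNIV\<close>.\<close>
  ultimately have "openin (order_topology_on S)
      ((\<Inter>p\<in>Restr r ?A. ?f p) \<inter> topspace (order_topology_on S))"
    by (intro openin_INT) auto
  also have "(\<Inter>p\<in>Restr r ?A. ?f p) \<inter> topspace (order_topology_on S)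
      = {r' \<in> total_orders S. Restr r ?A \<subseteq> r'}"
    unfolding order_topology_on_def by auto
  also have "\<dots> = filtration_nbhd S F n r"
    unfolding filtration_nbhd_def filtration_dist_less_iff[OF F]
    using total_orders_Restr_eq_iff[OF r _ A] by blast
  finally show ?thesis .
qed

lemma order_topology_on_eq_mtopology:
  assumes F: "filtration S F" and fin: "\<And>i. finite (F i)"
  shows "order_topology_on S
    = Metric_space.mtopology (total_orders S) (filtration_dist F)"
proof -
  interpret Metric_space "total_orders S" "filtration_dist F"
    using F by (rule Metric_space_filtration_dist)
  let ?B = "{{r \<in> total_orders S. (a, b) \<in> r} | a b. (a, b) \<in> S \<times> S}"
  show ?thesis
    unfolding order_topology_on_def
  proof (rule subbasis_topology_eqI)
    show "topspace mtopology = total_orders S" by simp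
    show "openin mtopology V" if "V \<in> ?B" for V
    proof -
      from that obtain a b where V: "V = {r \<in> total_orders S. (a, b) \<in> r}"
        and ab: "a \<in> S" "b \<in> S" by blast
      obtain n where n: "a \<in> F (Suc n)" "b \<in> F (Suc n)"
        using filtration_pair_eventually[OF F ab] .
      have "\<exists>W. openin mtopology W \<and> r \<in> W \<and> W \<subseteq> V" if "r \<in> V" for r
      proof (intro exI conjI)
        have r: "r \<in> total_orders S" "(a, b) \<in> r" using that V by auto
        show "openin mtopology (filtration_nbhd S F n r)"
          using filtration_nbhd_eq_mball[OF F r(1)] by simp
        show "r \<in> filtration_nbhd S F n r"
          using self_in_filtration_nbhd[OF F r(1)] .
        show "filtration_nbhd S F n r \<subseteq> V"
          unfolding filtration_nbhd_def filtration_dist_less_iff[OF F] V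
          using n r by blast
      qed
      then show ?thesis by (subst openin_subopen) blast
    qed
  next
    fix U r assume U: "openin mtopology U" "r \<in> U"
    then have r: "r \<in> total_orders S" using openin_subset by fastforce
    obtain n where "filtration_nbhd S F n r \<subseteq> U"
      using filtration_nbhd_basis[OF F U] .
    then show "\<exists>W. openin (subbasis_topology (total_orders S) ?B) W \<and> r \<in> W \<and> W \<subseteq> U"
      using openin_order_topology_on_filtration_nbhd[OF F fin r]
        self_in_filtration_nbhd[OF F r]
      unfolding order_topology_on_def by blast
  qed
qed

theorem theorem1p2:
  fixes S :: "'a set" and F :: "nat \<Rightarrow> 'a set"
  assumes "filtration S F"
    and "\<And>i. finite (F i)"
  shows "Metric_space (total_orders S) (filtration_dist F)
    \<and> Metric_space.mtopology (total_orders S) (filtration_dist F) = filtration_topology S F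
    \<and> filtration_topology S F = order_topology_on S
    \<and> (\<forall>G. filtration S G \<and> (\<forall>i. finite (G i)) \<longrightarrow>
          filtration_topology S G = filtration_topology S F)
    \<and> Hausdorff_space (order_topology_on S)"
proof -
  \<comment> \<open>The right side does not mention \<open>G\<close>, so proving this for every
    finite filtration yields independence of the choice.\<close>
  have eq: "filtration_topology S G = order_topology_on S"
    if "filtration S G" "\<And>i. finite (G i)" for G
    using filtration_topology_eq_mtopology[OF that(1)] order_topology_on_eq_mtopology[OF that]
    by simp
  have "Hausdorff_space (order_topology_on S)"
    unfolding order_topology_on_eq_mtopology[OF assms]
    by (rule Metric_space.Hausdorff_space_mtopology[OF Metric_space_filtration_dist[OF assms(1)]])
  then show ?thesis
    using Metric_space_filtration_dist[OF assms(1)] filtration_topology_eq_mtopology[OF assms(1)]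
      eq[OF assms] eq by simp
qed

end
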